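(* Let $k\geq 3$ be a fixed integer. Then $\mathrm{LT}(k,n)\geq \tfrac{1.02}{k}\,n-o(n)$ as $n\to\infty$.
   Context: For a positive integer $k$ let $[k]=\{1,2,\dots,k\}$; a word of length $n$ over $[k]$ is an element of $[k]^n$, and $w[i]$ is its $i$-th letter. A subsequence of $w$ is a word formed by letters of $w$ at positions $i_1<i_2<\dots<i_m$. Two subsequences of $w$ are called twins if they are equal as words and no position of $w$ is used in both. $\mathrm{LT}(w)$ denotes the maximum length of twins in $w$, and $\mathrm{LT}(k,n)=\min_{w\in[k]^n}\mathrm{LT}(w)$. *)

theory Defs
  imports Main "HOL-Library.Landau_Symbols"
begin

definition twins :: "nat list \<Rightarrow> nat set \<Rightarrow> nat set \<Rightarrow> bool" where
  "twins w I J \<longleftrightarrow> I \<subseteq> {..<length w} \<and> J \<subseteq> {..<length w} \<and> I \<inter> J = {}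
      \<and> nths w I = nths w J"

definition LT_word :: "nat list \<Rightarrow> nat" where
  "LT_word w = Max {length (nths w I) | I J. twins w I J}"

definition LT :: "nat \<Rightarrow> nat \<Rightarrow> nat" where
  "LT k n = Min {LT_word w | w. length w = n \<and> set w \<subseteq> {1..k}}"

end

theory Submission
  imports Defs "HOL-Library.Sublist"
begin

text \<open>
  Keeping only the three most frequent letters, at least \<open>3n/k\<close> positions survive, so it is enough to
  find twins of length \<open>0.34 n\<close> in every long word over three letters.

  Cut such a word into blocks with nearly equal letter frequencies. Let the first twin take, in the
  block \<open>X\<^sub>i\<close>, either a word over \<open>{a, b}\<close> contained in both \<open>X\<^sub>i\<close> and \<open>X\<^sub>i\<^sub>+\<^sub>s\<close>, or copies of
  the third letter \<open>c\<close>, switching every \<open>s\<close> blocks; the second twin does the same with a delay of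
  \<open>s\<close> blocks. Using single letters only, this gives length about \<open>n/3\<close>. The extra gain comes from
  the gaps between consecutive letters \<open>a\<close>: a gap containing some \<open>b\<close> in both blocks adds to the
  common word, and by Cauchy-Schwarz, averaged over the shift \<open>s\<close>, such coincidences are at least as
  frequent as for independent gaps. The gain is controlled by the number \<open>S\<close> of letters \<open>b\<close> in gaps
  of letters \<open>a\<close>, summed over all \<open>a \<noteq> b\<close>, with at most two counted per gap: the twins have length
  \<open>35n/108 + S/36\<close> up to small errors. If \<open>S\<close> is small, the word has long runs or alternating
  stretches, and there are twins of length \<open>n/2 - S/4\<close> between nearby positions. The weighted mean of
  the two bounds with weights \<open>9/10\<close> and \<open>1/10\<close> is \<open>41n/120 > 0.34n\<close>.

  Blocks with nearly equal frequencies exist at most scales, because otherwise the energy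
  (the sum of squared letter frequencies) would grow at too many of the scales.
\<close>

section \<open>Twins as disjoint subsequences\<close>

text \<open>Each letter of the word goes to the first subsequence, to the second or to neither, so
  disjointness of positions is built in and proofs are inductions on the word. Twins are the case
  \<open>u = v\<close>; the translation to index sets is \<open>disj_subseqs_imp_nths\<close> and
  \<open>nths_imp_disj_subseqs\<close>.\<close>

inductive disj_subseqs :: "'a list \<Rightarrow> 'a list \<Rightarrow> 'a list \<Rightarrow> bool" where
  Nil: "disj_subseqs [] [] []"
| skip: "disj_subseqs w u v \<Longrightarrow> disj_subseqs (x # w) u v"
| left: "disj_subseqs w u v \<Longrightarrow> disj_subseqs (x # w) (x # u) v"
| right: "disj_subseqs w u v \<Longrightarrow> disj_subseqs (x # w) u (x # v)"

lemma disj_subseqs_append: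
  "disj_subseqs w u v \<Longrightarrow> disj_subseqs w' u' v' \<Longrightarrow> disj_subseqs (w @ w') (u @ u') (v @ v')"
  by (induction rule: disj_subseqs.induct) (auto intro: disj_subseqs.intros)

lemma disj_subseqs_Nil: "disj_subseqs w [] []"
  by (induction w) (auto intro: disj_subseqs.intros)

lemma disj_subseqs_mono:
  assumes "subseq w w'" "disj_subseqs w u v"
  shows "disj_subseqs w' u v"
  using assms
proof (induction arbitrary: u v rule: list_emb.induct)
  case (list_emb_Nil ys)
  then show ?case by (auto elim: disj_subseqs.cases intro: disj_subseqs_Nil)
next
  case (list_emb_Cons xs ys y)
  then show ?case by (auto intro: disj_subseqs.intros)
next
  case (list_emb_Cons2 x y xs ys)
  from list_emb_Cons2.prems show ?case
    by cases (use list_emb_Cons2 in \<open>auto intro: disj_subseqs.intros\<close>)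
qed

text \<open>A position holds one letter, and this letter occurs in at most one of \<open>u\<close>
  and \<open>v\<close>, so two embeddings cannot compete for it.\<close>

lemma disj_subseqs_of_subseqs:
  assumes "subseq u w" "subseq v w" "set u \<inter> set v = {}"
  shows "disj_subseqs w u v"
  using assms
proof (induction w arbitrary: u v rule: list.induct)
  case Nil
  then show ?case by (metis list_emb_Nil2 disj_subseqs.Nil)
next
  case (Cons x w)
  show ?case
  proof (cases "subseq u w")
    case u: True
    show ?thesis
    proof (cases "subseq v w")
      case True
      with u Cons show ?thesis by (auto intro: disj_subseqs.intros)
    next
      case False
      with Cons.prems(2) obtain v' where "v = x # v'" "subseq v' w"
        by (auto elim: list_emb.cases)
      with u Cons show ?thesis by (auto intro: disj_subseqs.intros)
    qed
  next
    case False
    with Cons.prems(1) obtain u' where u': "u = x # u'" "subseq u' w"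
      by (auto elim: list_emb.cases)
    have "subseq v w"
      using Cons.prems(2,3) u' by (auto elim: list_emb.cases)
    with u' Cons show ?thesis by (auto intro: disj_subseqs.intros)
  qed
qed

lemma disj_subseqs_imp_nths:
  assumes "disj_subseqs w u v"
  shows "\<exists>I J. I \<subseteq> {..<length w} \<and> J \<subseteq> {..<length w} \<and> I \<inter> J = {} \<and> nths w I = u \<and> nths w J = v"
  using assms
proof induction
  case Nil
  then show ?case by auto
next
  case (skip w u v x)
  then obtain I J where "I \<subseteq> {..<length w}" "J \<subseteq> {..<length w}" "I \<inter> J = {}"
    "nths w I = u" "nths w J = v" by auto
  then show ?case
    by - (rule exI[of _ "Suc ` I"], rule exI[of _ "Suc ` J"], auto simp: nths_Cons inj_image_mem_iff)
next
  case (left w u v x)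
  then obtain I J where "I \<subseteq> {..<length w}" "J \<subseteq> {..<length w}" "I \<inter> J = {}"
    "nths w I = u" "nths w J = v" by auto
  then show ?case
    by - (rule exI[of _ "insert 0 (Suc ` I)"], rule exI[of _ "Suc ` J"], auto simp: nths_Cons inj_image_mem_iff)
next
  case (right w u v x)
  then obtain I J where "I \<subseteq> {..<length w}" "J \<subseteq> {..<length w}" "I \<inter> J = {}"
    "nths w I = u" "nths w J = v" by auto
  then show ?case
    by - (rule exI[of _ "Suc ` I"], rule exI[of _ "insert 0 (Suc ` J)"], auto simp: nths_Cons inj_image_mem_iff)
qed

lemma nths_imp_disj_subseqs:
  "I \<inter> J = {} \<Longrightarrow> disj_subseqs w (nths w I) (nths w J)"
proof (induction w arbitrary: I J)
  case Nil
  then show ?case by (auto intro: disj_subseqs.intros)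
next
  case (Cons x w)
  have "disj_subseqs w (nths w {j. Suc j \<in> I}) (nths w {j. Suc j \<in> J})"
    using Cons.prems by (intro Cons.IH) auto
  with Cons.prems show ?case by (auto simp: nths_Cons intro: disj_subseqs.intros)
qed

lemma finite_twin_lengths: "finite {length (nths w I) | I J. twins w I J}"
  by (rule finite_subset[of _ "(\<lambda>I. length (nths w I)) ` Pow {..<length w}"])
     (auto simp: twins_def)

lemma le_LT_word:
  assumes "disj_subseqs w u u"
  shows "length u \<le> LT_word w"
proof -
  have "\<exists>I J. twins w I J \<and> nths w I = u"
    unfolding twins_def using disj_subseqs_imp_nths[OF assms] by metis
  then obtain I J where "twins w I J" "nths w I = u" by blast
  then have "length u \<in> {length (nths w I) | I J. twins w I J}" by blast
  then show ?thesis
    unfolding LT_word_def by (intro Max_ge finite_twin_lengths)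
qed

lemma LT_word_witness:
  obtains u where "disj_subseqs w u u" "length u = LT_word w"
proof -
  have "twins w {} {}" by (simp add: twins_def)
  then have "LT_word w \<in> {length (nths w I) | I J. twins w I J}"
    unfolding LT_word_def by (intro Max_in finite_twin_lengths) blast
  then obtain I J where *: "LT_word w = length (nths w I)" "twins w I J" by auto
  then have "disj_subseqs w (nths w I) (nths w I)"
    using nths_imp_disj_subseqs[of I J w] by (auto simp: twins_def)
  with * that show thesis by simp
qed

lemma LT_word_append: "LT_word v + LT_word w \<le> LT_word (v @ w)"
proof -
  obtain s where "disj_subseqs v s s" "length s = LT_word v" by (rule LT_word_witness)
  moreover obtain t where "disj_subseqs w t t" "length t = LT_word w" by (rule LT_word_witness)
  ultimately show ?thesis
    using le_LT_word[of "v @ w" "s @ t"] by (simp add: disj_subseqs_append)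
qed

lemma LT_word_concat: "(\<Sum>i<length Xs. LT_word (Xs ! i)) \<le> LT_word (concat Xs)"
proof (induction Xs)
  case (Cons X Xs)
  then show ?case
    using LT_word_append[of X "concat Xs"] by (simp add: sum.lessThan_Suc_shift del: sum.lessThan_Suc)
qed simp

lemma LT_word_mono:
  assumes "subseq v w"
  shows "LT_word v \<le> LT_word w"
  using LT_word_witness[of v] disj_subseqs_mono[OF assms] le_LT_word[of w] by metis

section \<open>Gaps and twins between nearby positions\<close>

text \<open>
  \<open>gaps a b w\<close> has one entry for each \<open>a\<close> in \<open>w\<close>; letters \<open>b\<close> before the first \<open>a\<close> are not counted.
  \<open>weight\<close> is the quantity \<open>S\<close> of the introduction.
\<close>

definition lead :: "'a \<Rightarrow> 'a \<Rightarrow> 'a list \<Rightarrow> nat" where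
  "lead a b w = count_list (takeWhile (\<lambda>x. x \<noteq> a) w) b"

primrec gaps :: "'a \<Rightarrow> 'a \<Rightarrow> 'a list \<Rightarrow> nat list" where
  "gaps a b [] = []"
| "gaps a b (x # w) = (if x = a then lead a b w # gaps a b w else gaps a b w)"

lemma length_gaps: "length (gaps a b w) = count_list w a"
  by (induction w) auto

definition gap_weight :: "'a \<Rightarrow> 'a \<Rightarrow> 'a list \<Rightarrow> nat" where
  "gap_weight a b w = sum_list (map (min 2) (gaps a b w))"

definition weight :: "'a set \<Rightarrow> 'a list \<Rightarrow> nat" where
  "weight A w = (\<Sum>a\<in>A. \<Sum>b\<in>A - {a}. gap_weight a b w)"

lemma gap_weight_Cons:
  "gap_weight a b (x # w) = gap_weight a b w + (if x = a then min 2 (lead a b w) else 0)"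
  by (simp add: gap_weight_def)

text \<open>Gaps look to the right of their letter: prepending \<open>x\<close> leaves all old
  entries unchanged and only creates the gap of \<open>x\<close> itself.\<close>

lemma weight_Cons:
  assumes "finite A" "x \<in> A"
  shows "weight A (x # w) = weight A w + (\<Sum>b\<in>A - {x}. min 2 (lead x b w))"
proof -
  have "weight A (x # w) = weight A w + (\<Sum>a\<in>A. \<Sum>b\<in>A - {a}. if x = a then min 2 (lead a b w) else 0)"
    by (simp add: weight_def gap_weight_Cons sum.distrib)
  also have "(\<Sum>a\<in>A. \<Sum>b\<in>A - {a}. if x = a then min 2 (lead a b w) else 0)
      = (\<Sum>a\<in>A. if x = a then (\<Sum>b\<in>A - {a}. min 2 (lead a b w)) else 0)"
    by (intro sum.cong) auto
  also have "\<dots> = (\<Sum>b\<in>A - {x}. min 2 (lead x b w))"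
    using assms by simp
  finally show ?thesis .
qed

lemma weight_Cons_ge:
  assumes "finite A" "x \<in> A" "B \<subseteq> A - {x}"
  shows "weight A w + (\<Sum>b\<in>B. min 2 (lead x b w)) \<le> weight A (x # w)"
  using assms by (simp add: weight_Cons sum_mono2)

lemma weight_Cons_ge1:
  assumes "finite A" "x \<in> A" "y \<in> A" "x \<noteq> y"
  shows "weight A w + min 2 (lead x y w) \<le> weight A (x # w)"
  using weight_Cons_ge[of A x "{y}" w] assms by simp

lemma weight_Cons_mono:
  assumes "finite A" "x \<in> A"
  shows "weight A w \<le> weight A (x # w)"
  using weight_Cons_ge[of A x "{}" w] assms by simp

lemma lead_Nil [simp]: "lead a b [] = 0"
  by (simp add: lead_def)

lemma lead_Cons [simp]:
  "lead a b (x # w) = (if x = a then 0 else (if x = b then 1 else 0) + lead a b w)"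
  by (cases "x = a"; cases "x = b") (simp_all add: lead_def)

text \<open>Greedy induction from the left: each step removes r letters, adds t letters to both
  twins and lowers the weight by at least d, where \<open>2 r \<le> 4 t + d\<close>. A prefix
  \<open>x x\<close> gives r = 2, t = 1, and the constant 8 pays for a rest of at most four
  letters.\<close>

lemma LT_word_weight_ge:
  assumes "finite A" "set w \<subseteq> A"
  shows "2 * length w \<le> 4 * LT_word w + weight A w + 8"
proof -
  have "\<exists>u. disj_subseqs w u u \<and> 2 * length w \<le> 4 * length u + weight A w + 8"
    using assms(2)
  proof (induction w rule: length_induct)
    case (1 w)
    note ds = disj_subseqs.intros
    have IH: "\<exists>u. disj_subseqs v u u \<and> 2 * length v \<le> 4 * length u + weight A v + 8"
      if "length v < length w" "set v \<subseteq> A" for v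
      using 1 that by blast
    show ?case
    proof (cases "\<exists>x v. w = x # x # v")
      case True
      then obtain x v where w: "w = x # x # v" by auto
      then obtain u where "disj_subseqs v u u" "2 * length v \<le> 4 * length u + weight A v + 8"
        using IH[of v] 1(2) by auto
      moreover have "weight A v \<le> weight A w"
        using weight_Cons_mono[of A x v] weight_Cons_mono[of A x "x # v"] 1 w assms(1) by auto
      ultimately show ?thesis
        using w by (intro exI[of _ "x # u"]) (auto intro: ds)
    next
      case nxx: False
      show ?thesis
      proof (cases "length w \<le> 4")
        case True
        then show ?thesis by (auto intro!: exI[of _ "[]"] disj_subseqs_Nil)
      next
        case False
        then obtain x y z p q v where w: "w = x # y # z # p # q # v"
          by (auto simp: not_le less_eq_Suc_le numeral_eq_Suc Suc_le_length_iff)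
        have A: "x \<in> A" "y \<in> A" "z \<in> A" "p \<in> A" "q \<in> A" "set v \<subseteq> A"
          using 1(2) w by auto
        have xy: "x \<noteq> y" using nxx w by auto
        \<comment> \<open>The triples (r, t, d) in the five cases are (1,0,2), (1,0,2), (3,1,3),
          (5,2,2) and (4,1,4). The weight d comes from the gaps that open at the removed
          letters.\<close>
        consider "z = y" | "z \<noteq> x" "z \<noteq> y" | "z = x" "p \<noteq> x"
          | "z = x" "p = x" "q = x" | "z = x" "p = x" "q \<noteq> x" by blast
        then show ?thesis
        proof cases
          case 1
          obtain u where u: "disj_subseqs (y # z # p # q # v) u u"
            "2 * length (y # z # p # q # v) \<le> 4 * length u + weight A (y # z # p # q # v) + 8"
            using IH[of "y # z # p # q # v"] w A by auto
          moreover have "weight A (y # z # p # q # v) + 2 \<le> weight A w"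
            using weight_Cons_ge1[of A x y "y # z # p # q # v"] assms(1) A xy 1 w by auto
          ultimately show ?thesis
            using w by (intro exI[of _ u]) (simp add: ds(2))
        next
          case 2
          obtain u where u: "disj_subseqs (y # z # p # q # v) u u"
            "2 * length (y # z # p # q # v) \<le> 4 * length u + weight A (y # z # p # q # v) + 8"
            using IH[of "y # z # p # q # v"] w A by auto
          moreover have "weight A (y # z # p # q # v) + 2 \<le> weight A w"
          proof -
            have "1 \<le> min 2 (lead x b (y # z # p # q # v))" if "b \<in> {y, z}" for b
              using that xy 2 by auto
            then have "(\<Sum>b\<in>{y, z}. 1 :: nat) \<le> (\<Sum>b\<in>{y, z}. min 2 (lead x b (y # z # p # q # v)))"
              by (rule sum_mono)
            moreover have "(\<Sum>b\<in>{y, z}. 1 :: nat) = 2"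
              using 2 by simp
            moreover have "weight A (y # z # p # q # v) + (\<Sum>b\<in>{y, z}. min 2 (lead x b (y # z # p # q # v))) \<le> weight A w"
              unfolding w by (rule weight_Cons_ge) (use assms(1) A xy 2 in auto)
            ultimately show ?thesis by linarith
          qed
          ultimately show ?thesis
            using w by (intro exI[of _ u]) (simp add: ds(2))
        next
          case 3
          obtain u where u: "disj_subseqs (p # q # v) u u"
            "2 * length (p # q # v) \<le> 4 * length u + weight A (p # q # v) + 8"
            using IH[of "p # q # v"] w A by auto
          moreover have "weight A (p # q # v) + 1 \<le> weight A (z # p # q # v)"
            using weight_Cons_ge1[of A x p "p # q # v"] assms(1) A 3 by auto
          moreover have "weight A (z # p # q # v) + 1 \<le> weight A (y # z # p # q # v)"
            using weight_Cons_ge1[of A y x "z # p # q # v"] assms(1) A xy 3 by auto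
          moreover have "weight A (y # z # p # q # v) + 1 \<le> weight A w"
            using weight_Cons_ge1[of A x y "y # z # p # q # v"] assms(1) A xy 3 w by auto
          ultimately show ?thesis
            using w 3 by (intro exI[of _ "x # u"]) (auto intro!: ds(2-))
        next
          case 4
          obtain u where u: "disj_subseqs v u u"
            "2 * length v \<le> 4 * length u + weight A v + 8"
            using IH[of v] w A by auto
          moreover have "weight A v \<le> weight A (z # p # q # v)"
            using weight_Cons_mono[OF assms(1)] A by (meson order_trans)
          moreover have "weight A (z # p # q # v) + 2 \<le> weight A (y # z # p # q # v)"
            using weight_Cons_ge1[of A y x "z # p # q # v"] assms(1) A xy 4 by auto
          moreover have "weight A (y # z # p # q # v) \<le> weight A w"
            using weight_Cons_mono[of A x "y # z # p # q # v"] assms(1) A w by auto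
          moreover have "disj_subseqs w (x # x # u) (x # x # u)"
            unfolding w using 4 u(1) by (simp add: ds)
          ultimately show ?thesis
            using w 4 by (intro exI[of _ "x # x # u"]) auto
        next
          case 5
          obtain u where u: "disj_subseqs (q # v) u u"
            "2 * length (q # v) \<le> 4 * length u + weight A (q # v) + 8"
            using IH[of "q # v"] w A by auto
          moreover have "weight A (q # v) + 1 \<le> weight A (p # q # v)"
            using weight_Cons_ge1[of A x q "q # v"] assms(1) A 5 by auto
          moreover have "weight A (p # q # v) \<le> weight A (z # p # q # v)"
            using weight_Cons_mono[OF assms(1)] A by auto
          moreover have "weight A (z # p # q # v) + 2 \<le> weight A (y # z # p # q # v)"
            using weight_Cons_ge1[of A y x "z # p # q # v"] assms(1) A xy 5 by auto
          moreover have "weight A (y # z # p # q # v) + 1 \<le> weight A w"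
            using weight_Cons_ge1[of A x y "y # z # p # q # v"] assms(1) A xy 5 w by auto
          moreover have "disj_subseqs w (x # u) (x # u)"
            unfolding w using 5 u(1) by (simp add: ds)
          ultimately show ?thesis
            using w 5 by (intro exI[of _ "x # u"]) auto
        qed
      qed
    qed
  qed
  then show ?thesis using le_LT_word by fastforce
qed

section \<open>Delayed twins\<close>

lemma disj_subseqs_concat:
  assumes "\<And>i. i < length Xs \<Longrightarrow> disj_subseqs (Xs ! i) (f i) (g i)"
  shows "disj_subseqs (concat Xs) (concat (map f [0..<length Xs])) (concat (map g [0..<length Xs]))"
  using assms
proof (induction Xs rule: rev_induct)
  case Nil
  then show ?case by (simp add: disj_subseqs.Nil)
next
  case (snoc X Xs)
  have "disj_subseqs (Xs ! i) (f i) (g i)" if "i < length Xs" for i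
    using snoc.prems[of i] that by (simp add: nth_append)
  moreover have "disj_subseqs X (f (length Xs)) (g (length Xs))"
    using snoc.prems[of "length Xs"] by simp
  ultimately show ?case
    using snoc.IH by (simp add: disj_subseqs_append)
qed

text \<open>The first twin reads \<open>\<alpha> i\<close> in block i, the second reads it in block
  i + s. A block thus has to hold \<open>\<alpha> i\<close> and \<open>\<alpha> (i - s)\<close>,
  which share no letter.\<close>

lemma delayed_twins:
  assumes sub: "\<And>i. i + s < length Xs \<Longrightarrow> subseq (\<alpha> i) (Xs ! i)"
      "\<And>i. i + s < length Xs \<Longrightarrow> subseq (\<alpha> i) (Xs ! (i + s))"
    and disj: "\<And>i. set (\<alpha> i) \<inter> set (\<alpha> (i + s)) = {}"
  shows "(\<Sum>i<length Xs - s. length (\<alpha> i)) \<le> LT_word (concat Xs)"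
proof (cases "s \<le> length Xs")
  case True
  define m where "m = length Xs"
  \<comment> \<open>The last s blocks give nothing to the first twin and the first s blocks nothing
    to the second; dropping these empty parts leaves the same word twice.\<close>
  define f where "f i = (if i + s < m then \<alpha> i else [])" for i
  define g where "g i = (if i < s then [] else \<alpha> (i - s))" for i
  have "disj_subseqs (Xs ! i) (f i) (g i)" if "i < length Xs" for i
  proof (rule disj_subseqs_of_subseqs)
    show "subseq (f i) (Xs ! i)" using sub(1) by (auto simp: f_def m_def)
    show "subseq (g i) (Xs ! i)" using sub(2)[of "i - s"] that by (auto simp: g_def m_def)
    show "set (f i) \<inter> set (g i) = {}" using disj[of "i - s"] by (auto simp: f_def g_def)
  qed
  then have "disj_subseqs (concat Xs) (concat (map f [0..<m])) (concat (map g [0..<m]))"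
    unfolding m_def by (rule disj_subseqs_concat)
  moreover have split: "[0..<m] = [0..<m - s] @ [m - s..<m]" "[0..<m] = [0..<s] @ map (\<lambda>i. i + s) [0..<m - s]"
    using True upt_add_eq_append[of 0 "m - s" s] upt_add_eq_append[of 0 s "m - s"]
    by (auto simp: m_def map_add_upt)
  have "concat (map f [0..<m]) = concat (map \<alpha> [0..<m - s])"
  proof -
    have "map f [0..<m - s] = map \<alpha> [0..<m - s]" by (intro map_cong) (auto simp: f_def)
    moreover have "concat (map f [m - s..<m]) = []" by (auto simp: f_def)
    ultimately show ?thesis by (simp only: split(1) map_append concat_append append_Nil2)
  qed
  moreover have "concat (map g [0..<m]) = concat (map \<alpha> [0..<m - s])"
  proof -
    have "map g (map (\<lambda>i. i + s) [0..<m - s]) = map \<alpha> [0..<m - s]"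
      unfolding map_map by (intro map_cong) (auto simp: g_def)
    moreover have "concat (map g [0..<s]) = []" by (auto simp: g_def)
    ultimately show ?thesis by (simp only: split(2) map_append concat_append append_Nil)
  qed
  ultimately have "length (concat (map \<alpha> [0..<m - s])) \<le> LT_word (concat Xs)"
    by (intro le_LT_word) simp
  then show ?thesis
    by (simp add: length_concat m_def comp_def interv_sum_list_conv_sum_set_nat atLeast0LessThan)
qed simp

section \<open>Common subsequences of two blocks\<close>

text \<open>For the gap lists of two words this aligns the t-th letter \<open>a\<close> of one with
  the t-th letter \<open>a\<close> of the other and keeps as many \<open>b\<close> in between as
  both gaps offer.\<close>

definition common :: "'a \<Rightarrow> 'a \<Rightarrow> nat list \<Rightarrow> nat list \<Rightarrow> 'a list" where
  "common a b gs hs = concat (map2 (\<lambda>g h. a # replicate (min g h) b) gs hs)"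

lemma common_simps [simp]:
  "common a b [] hs = []" "common a b gs [] = []"
  "common a b (g # gs) (h # hs) = a # replicate (min g h) b @ common a b gs hs"
  by (simp_all add: common_def)

lemma common_commute: "common a b gs hs = common a b hs gs"
  by (induction gs hs rule: list_induct2') (auto simp: min.commute)

lemma set_common: "set (common a b gs hs) \<subseteq> {a, b}"
  by (induction gs hs rule: list_induct2') auto

text \<open>The prefix of n letters \<open>b\<close> stands for the part of the current gap still to
  be read; it makes the induction on the word work. Only n = 0 is used later.\<close>

lemma subseq_lead_common:
  assumes "a \<noteq> b" "n \<le> lead a b w"
  shows "subseq (replicate n b @ common a b (gaps a b w) hs) w"
  using assms(2)
proof (induction w arbitrary: n hs)
  case Nil
  then show ?case by simp
next
  case (Cons x w)
  show ?case
  proof (cases "x = a")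
    case True
    with Cons.prems Cons.IH[of "min (lead a b w) (hd hs)" "tl hs"] show ?thesis
      by (cases hs) auto
  next
    case False
    then show ?thesis
      using Cons.prems Cons.IH[of n hs] Cons.IH[of "n - 1" hs] by (cases n) (auto split: if_splits)
  qed
qed

lemma subseq_common:
  assumes "a \<noteq> b"
  shows "subseq (common a b (gaps a b v) (gaps a b w)) v"
    and "subseq (common a b (gaps a b v) (gaps a b w)) w"
  using subseq_lead_common[OF assms, of 0 v "gaps a b w"]
    subseq_lead_common[OF assms, of 0 w "gaps a b v"]
  by (simp_all add: common_commute)

lemma subseq_replicate_count:
  "n \<le> count_list w c \<Longrightarrow> subseq (replicate n c) w"
proof (induction w arbitrary: n)
  case (Cons x w)
  then show ?case
    using Cons.IH[of n] Cons.IH[of "n - 1"] by (cases n) (auto split: if_splits)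
qed simp

text \<open>What a pair of blocks yields in the \<open>{a, b}\<close> mode and in the
  \<open>c\<close> mode together.\<close>

definition overlap :: "'a \<Rightarrow> 'a \<Rightarrow> 'a \<Rightarrow> 'a list \<Rightarrow> 'a list \<Rightarrow> nat" where
  "overlap a b c v w = length (common a b (gaps a b v) (gaps a b w)) + min (count_list v c) (count_list w c)"

lemma overlap_commute: "overlap a b c v w = overlap a b c w v"
  by (simp add: overlap_def common_commute min.commute)

text \<open>The mode depends on the parity of \<open>i div s\<close>, so blocks i and i + s are
  always in opposite modes and \<open>delayed_twins\<close> applies. The two phases, even and odd,
  use each mode once for every i, hence the factor 2.\<close>

lemma sum_overlap_le:
  assumes "distinct [a, b, c]" "s > 0"
  shows "(\<Sum>i<length Xs - s. overlap a b c (Xs ! i) (Xs ! (i + s))) \<le> 2 * LT_word (concat Xs)"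
proof -
  let ?p = "\<lambda>i. common a b (gaps a b (Xs ! i)) (gaps a b (Xs ! (i + s)))"
  let ?r = "\<lambda>i. replicate (min (count_list (Xs ! i) c) (count_list (Xs ! (i + s)) c)) c"
  define \<alpha> where "\<alpha> P i = (if P (i div s) then ?p i else ?r i)" for P i
  have *: "(\<Sum>i<length Xs - s. length (\<alpha> P i)) \<le> LT_word (concat Xs)"
    if "\<And>i. P (Suc i) \<longleftrightarrow> \<not> P i" for P
  proof (rule delayed_twins)
    fix i
    show "subseq (\<alpha> P i) (Xs ! i)" "subseq (\<alpha> P i) (Xs ! (i + s))"
      using assms by (auto simp: \<alpha>_def intro: subseq_common subseq_replicate_count)
    have "set (?p i) \<inter> {c} = {}" for i
      using set_common[of a b] assms(1) by fastforce
    moreover have "set (?r i) \<subseteq> {c}" for i by auto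
    ultimately show "set (\<alpha> P i) \<inter> set (\<alpha> P (i + s)) = {}"
      using assms(2) that[of "i div s"] unfolding \<alpha>_def by (auto; blast)
  qed
  have "(\<Sum>i<length Xs - s. overlap a b c (Xs ! i) (Xs ! (i + s)))
      = (\<Sum>i<length Xs - s. length (\<alpha> even i)) + (\<Sum>i<length Xs - s. length (\<alpha> odd i))"
    by (auto simp: overlap_def \<alpha>_def sum.distrib[symmetric] intro!: sum.cong)
  also have "\<dots> \<le> 2 * LT_word (concat Xs)"
    using *[of even] *[of odd] by simp
  finally show ?thesis .
qed

section \<open>Cauchy-Schwarz for gap lists\<close>

text \<open>
  \<open>level 0\<close> marks the letters \<open>a\<close>, \<open>level 1\<close> and \<open>level 2\<close> the gaps with at least one or two letters \<open>b\<close>: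
  \<open>1 + min g h\<close> is at least the sum of the products of the three levels of the gaps \<open>g\<close> and \<open>h\<close>.
\<close>

definition level :: "nat \<Rightarrow> nat list \<Rightarrow> nat \<Rightarrow> real" where
  "level j gs t = of_bool (t < length gs \<and> j \<le> gs ! t)"

lemma level_simps [simp]:
  "level j [] t = 0" "level j (g # gs) 0 = of_bool (j \<le> g)" "level j (g # gs) (Suc t) = level j gs t"
  by (simp_all add: level_def)

lemma sum_level_length: "length gs \<le> N \<Longrightarrow> (\<Sum>t<N. level 0 gs t) = length gs"
proof (induction gs arbitrary: N)
  case (Cons g gs)
  then show ?case by (cases N) (simp_all add: sum.lessThan_Suc_shift del: sum.lessThan_Suc)
qed simp

lemma sum_level_min: "length gs \<le> N \<Longrightarrow>
    (\<Sum>t<N. level 1 gs t) + (\<Sum>t<N. level 2 gs t) = real (sum_list (map (min 2) gs))"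
proof (induction gs arbitrary: N)
  case (Cons g gs)
  then obtain M where "N = Suc M" "length gs \<le> M" by (cases N) auto
  moreover have "of_bool (1 \<le> g) + of_bool (2 \<le> g) = real (min 2 g)" by auto
  ultimately show ?case
    using Cons.IH[of M] by (simp add: sum.lessThan_Suc_shift del: sum.lessThan_Suc)
qed simp

lemma sum_level_le_common:
  "(\<Sum>t<N. level 0 gs t * level 0 hs t + level 1 gs t * level 1 hs t + level 2 gs t * level 2 hs t)
     \<le> length (common a b gs hs)"
proof (induction gs hs arbitrary: N rule: list_induct2')
  case (4 g gs h hs)
  show ?case
  proof (cases N)
    case (Suc M)
    have "1 + of_bool (1 \<le> g) * of_bool (1 \<le> h) + of_bool (2 \<le> g) * of_bool (2 \<le> h) \<le> (1 + real (min g h))"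
      by auto
    with 4[of M] Suc show ?thesis by (simp add: sum.lessThan_Suc_shift del: sum.lessThan_Suc)
  qed simp
qed simp_all

lemma sum_level_product:
  assumes "length gs \<le> N"
  shows "(\<Sum>t<N. level 0 gs t * level 0 hs t) = min (length gs) (length hs)"
  using assms
proof (induction gs hs arbitrary: N rule: list_induct2')
  case (4 g gs h hs)
  then show ?case by (cases N) (simp_all add: sum.lessThan_Suc_shift del: sum.lessThan_Suc)
qed simp_all

text \<open>Since \<open>level j\<close> is at most \<open>level 0\<close>, what is lost is at most
  the number of letters \<open>a\<close> without a partner in the other list.\<close>

lemma sum_level_cross:
  assumes "length gs \<le> N"
  shows "(\<Sum>t<N. level j gs t * level 0 hs t) \<ge> (\<Sum>t<N. level j gs t) - \<bar>real (length gs) - real (length hs)\<bar>"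
proof -
  have "(\<Sum>t<N. level j gs t) - (\<Sum>t<N. level j gs t * level 0 hs t)
      \<le> (\<Sum>t<N. level 0 gs t) - (\<Sum>t<N. level 0 gs t * level 0 hs t)"
    unfolding sum_subtractf[symmetric] by (rule sum_mono) (auto simp: level_def)
  also have "\<dots> = real (length gs) - min (length gs) (length hs)"
    using assms by (simp add: sum_level_length sum_level_product)
  also have "\<dots> \<le> \<bar>real (length gs) - real (length hs)\<bar>" by auto
  finally show ?thesis by linarith
qed

text \<open>This expands \<open>(sum f U - c * sum g U)\<^sup>2 \<ge> 0\<close>. It replaces
  Cauchy-Schwarz by a tangent bound that is linear in f, so that it can be summed over all gap
  indices t.\<close>

lemma sum_product_tangent:
  fixes f g :: "'b \<Rightarrow> real"
  shows "(\<Sum>u\<in>U. \<Sum>v\<in>U. f u * f v) \<ge> (\<Sum>u\<in>U. \<Sum>v\<in>U. 2 * c * (f u * g v) - c\<^sup>2 * (g u * g v))"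
proof -
  have "0 \<le> (sum f U - c * sum g U)\<^sup>2" by simp
  also have "\<dots> = sum f U * sum f U - (2 * c * (sum f U * sum g U) - c\<^sup>2 * (sum g U * sum g U))"
    by (simp add: power2_eq_square algebra_simps)
  finally show ?thesis
    unfolding sum_product by (simp add: sum_subtractf sum_distrib_left)
qed

text \<open>For each index t, level 0 is evaluated exactly, and levels 1 and 2 are compared with
  level 0 by the tangent bound with c = 1/6. This gives 1/3 = 2c for the gap weight and 17/18 = 1 -
  2/36 for the letters \<open>a\<close>; each of the two levels costs a third of the difference in
  length.\<close>

lemma sum_common_ge:
  assumes "\<And>u. u \<in> U \<Longrightarrow> length (gs u) \<le> N"
  shows "(\<Sum>u\<in>U. \<Sum>v\<in>U. real (length (common a b (gs u) (gs v)))) \<ge>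
    (\<Sum>u\<in>U. \<Sum>v\<in>U. 17 / 18 * min (length (gs u)) (length (gs v)) + real (sum_list (map (min 2) (gs u))) / 3
       - 2 / 3 * \<bar>real (length (gs u)) - real (length (gs v))\<bar>)"
proof -
  let ?T = "\<lambda>j u v. \<Sum>t<N. level j (gs u) t * level j (gs v) t"
  \<comment> \<open>\<open>1/6\<close> is close to the proportion of nonempty gaps in the worst case, where the tangent bound is sharp.\<close>
  have tangent: "(\<Sum>u\<in>U. \<Sum>v\<in>U. ?T j u v) \<ge>
    (\<Sum>u\<in>U. \<Sum>v\<in>U. (\<Sum>t<N. level j (gs u) t) / 3 - \<bar>real (length (gs u)) - real (length (gs v))\<bar> / 3
       - min (length (gs u)) (length (gs v)) / 36)" for j
  proof -
    have "(\<Sum>u\<in>U. \<Sum>v\<in>U. (\<Sum>t<N. level j (gs u) t) / 3 - \<bar>real (length (gs u)) - real (length (gs v))\<bar> / 3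
       - min (length (gs u)) (length (gs v)) / 36)
      \<le> (\<Sum>u\<in>U. \<Sum>v\<in>U. (\<Sum>t<N. level j (gs u) t * level 0 (gs v) t) / 3
           - (\<Sum>t<N. level 0 (gs u) t * level 0 (gs v) t) / 36)"
    proof (intro sum_mono)
      fix u v assume "u \<in> U" "v \<in> U"
      then show "(\<Sum>t<N. level j (gs u) t) / 3 - \<bar>real (length (gs u)) - real (length (gs v))\<bar> / 3
          - min (length (gs u)) (length (gs v)) / 36
        \<le> (\<Sum>t<N. level j (gs u) t * level 0 (gs v) t) / 3 - (\<Sum>t<N. level 0 (gs u) t * level 0 (gs v) t) / 36"
        using sum_level_cross[of "gs u" N j "gs v"] assms[of u] by (simp add: sum_level_product)
    qed
    also have "\<dots> = (\<Sum>u\<in>U. \<Sum>v\<in>U. \<Sum>t<N. 2 * (1 / 6) * (level j (gs u) t * level 0 (gs v) t)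
           - (1 / 6)\<^sup>2 * (level 0 (gs u) t * level 0 (gs v) t))"
      by (simp add: sum_subtractf sum_divide_distrib power2_eq_square)
    also have "\<dots> = (\<Sum>t<N. \<Sum>u\<in>U. \<Sum>v\<in>U. 2 * (1 / 6) * (level j (gs u) t * level 0 (gs v) t)
           - (1 / 6)\<^sup>2 * (level 0 (gs u) t * level 0 (gs v) t))"
      by (simp add: sum.swap[of _ "{..<N}"])
    also have "\<dots> \<le> (\<Sum>t<N. \<Sum>u\<in>U. \<Sum>v\<in>U. level j (gs u) t * level j (gs v) t)"
      by (intro sum_mono sum_product_tangent)
    also have "\<dots> = (\<Sum>u\<in>U. \<Sum>v\<in>U. ?T j u v)"
      by (simp add: sum.swap[of _ "{..<N}"])
    finally show ?thesis .
  qed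
  have "(\<Sum>u\<in>U. \<Sum>v\<in>U. 17 / 18 * min (length (gs u)) (length (gs v)) + real (sum_list (map (min 2) (gs u))) / 3
       - 2 / 3 * \<bar>real (length (gs u)) - real (length (gs v))\<bar>)
     = (\<Sum>u\<in>U. \<Sum>v\<in>U. ?T 0 u v)
       + (\<Sum>u\<in>U. \<Sum>v\<in>U. (\<Sum>t<N. level 1 (gs u) t) / 3 - \<bar>real (length (gs u)) - real (length (gs v))\<bar> / 3
           - min (length (gs u)) (length (gs v)) / 36)
       + (\<Sum>u\<in>U. \<Sum>v\<in>U. (\<Sum>t<N. level 2 (gs u) t) / 3 - \<bar>real (length (gs u)) - real (length (gs v))\<bar> / 3
           - min (length (gs u)) (length (gs v)) / 36)"
    unfolding sum.distrib[symmetric]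
  proof (intro sum.cong refl)
    fix u v assume "u \<in> U" "v \<in> U"
    then show "17 / 18 * min (length (gs u)) (length (gs v)) + real (sum_list (map (min 2) (gs u))) / 3
       - 2 / 3 * \<bar>real (length (gs u)) - real (length (gs v))\<bar>
      = ?T 0 u v + ((\<Sum>t<N. level 1 (gs u) t) / 3 - \<bar>real (length (gs u)) - real (length (gs v))\<bar> / 3
           - min (length (gs u)) (length (gs v)) / 36)
       + ((\<Sum>t<N. level 2 (gs u) t) / 3 - \<bar>real (length (gs u)) - real (length (gs v))\<bar> / 3
           - min (length (gs u)) (length (gs v)) / 36)"
      using sum_level_min[of "gs u" N] assms[of u] by (simp add: sum_level_product)
  qed
  also have "\<dots> \<le> (\<Sum>u\<in>U. \<Sum>v\<in>U. ?T 0 u v) + (\<Sum>u\<in>U. \<Sum>v\<in>U. ?T 1 u v) + (\<Sum>u\<in>U. \<Sum>v\<in>U. ?T 2 u v)"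
    using tangent[of 1] tangent[of 2] by linarith
  also have "\<dots> \<le> (\<Sum>u\<in>U. \<Sum>v\<in>U. real (length (common a b (gs u) (gs v))))"
    unfolding sum.distrib[symmetric] by (intro sum_mono sum_level_le_common)
  finally show ?thesis .
qed

section \<open>Averaging over windows of blocks\<close>

lemma window_sum_le:
  fixes f :: "nat \<Rightarrow> 'b::linordered_semidom"
  assumes "\<And>i. i < n \<Longrightarrow> 0 \<le> f i" "W + u \<le> n"
  shows "(\<Sum>w<W. f (w + u)) \<le> (\<Sum>i<n. f i)"
proof -
  have "(\<Sum>w<W. f (w + u)) = (\<Sum>i\<in>{u..<W + u}. f i)"
    using sum.shift_bounds_nat_ivl[of f 0 u W] by (simp add: atLeast0LessThan)
  also have "\<dots> \<le> (\<Sum>i<n. f i)"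
    using assms by (intro sum_mono2) auto
  finally show ?thesis .
qed

lemma overlap_self_le:
  assumes "a \<noteq> b"
  shows "overlap a b c w w \<le> 2 * length w"
  using list_emb_length[OF subseq_common(1)[OF assms, of w w]] count_le_length[of w c]
  by (simp add: overlap_def)

text \<open>For fixed u and v the two blocks always have distance |u - v|, so the sum over all
  windows is part of the sum in \<open>sum_overlap_le\<close> for this shift.\<close>

lemma window_overlap_le:
  assumes "distinct [a, b, c]" "u < q" "v < q" "u \<noteq> v" "q \<le> length Xs"
  shows "(\<Sum>w<length Xs - q + 1. overlap a b c (Xs ! (w + u)) (Xs ! (w + v))) \<le> 2 * LT_word (concat Xs)"
proof -
  have *: "(\<Sum>w<length Xs - q + 1. overlap a b c (Xs ! (w + u)) (Xs ! (w + v))) \<le> 2 * LT_word (concat Xs)"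
    if "u < v" "v < q" for u v
  proof -
    have "(\<Sum>w<length Xs - q + 1. overlap a b c (Xs ! (w + u)) (Xs ! (w + u + (v - u))))
      \<le> (\<Sum>i<length Xs - (v - u). overlap a b c (Xs ! i) (Xs ! (i + (v - u))))"
      using that assms by (intro window_sum_le[where f = "\<lambda>i. overlap a b c (Xs ! i) (Xs ! (i + (v - u)))"]) auto
    also have "\<dots> \<le> 2 * LT_word (concat Xs)"
      using that assms by (intro sum_overlap_le) auto
    finally show ?thesis using that by (simp add: algebra_simps)
  qed
  show ?thesis
  proof (cases "u < v")
    case True
    then show ?thesis using * assms by blast
  next
    case False
    then show ?thesis using *[of v u] assms by (simp add: overlap_commute)
  qed
qed

lemma sum_window_overlap_le:
  fixes q l :: nat
  assumes "distinct [a, b, c]" "q \<le> length Xs" "\<And>X. X \<in> set Xs \<Longrightarrow> length X = l"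
  defines "W \<equiv> length Xs - q + 1"
  shows "(\<Sum>w<W. \<Sum>u<q. \<Sum>v<q. real (overlap a b c (Xs ! (w + u)) (Xs ! (w + v))))
    \<le> 2 * real q * real q * real (LT_word (concat Xs)) + 2 * real q * real l * real W"
proof -
  let ?T = "real (LT_word (concat Xs))"
  have "(\<Sum>w<W. \<Sum>u<q. \<Sum>v<q. real (overlap a b c (Xs ! (w + u)) (Xs ! (w + v))))
    = (\<Sum>u<q. \<Sum>v<q. \<Sum>w<W. real (overlap a b c (Xs ! (w + u)) (Xs ! (w + v))))"
    by (rule trans[OF sum.swap sum.cong[OF refl sum.swap]])
  also have "\<dots> \<le> (\<Sum>u<q. \<Sum>v<q. 2 * ?T + (if u = v then 2 * real l * real W else 0))"
  proof (intro sum_mono)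
    fix u v assume uv: "u \<in> {..<q}" "v \<in> {..<q}"
    show "(\<Sum>w<W. real (overlap a b c (Xs ! (w + u)) (Xs ! (w + v))))
       \<le> 2 * ?T + (if u = v then 2 * real l * real W else 0)"
    proof (cases "u = v")
      case True
      have "(\<Sum>w<W. real (overlap a b c (Xs ! (w + u)) (Xs ! (w + v)))) \<le> (\<Sum>w<W. 2 * real l)"
      proof (intro sum_mono)
        fix w assume "w \<in> {..<W}"
        then have "w + u < length Xs" using uv assms(2) by (auto simp: W_def)
        then show "real (overlap a b c (Xs ! (w + u)) (Xs ! (w + v))) \<le> 2 * real l"
          using overlap_self_le[of a b c "Xs ! (w + u)"] assms(1,3) True by (simp add: of_nat_mono[of _ "2 * l", simplified])
      qed
      then show ?thesis using True by (simp add: algebra_simps)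
    next
      case False
      with window_overlap_le[of a b c u q v Xs] assms uv
      have "real (\<Sum>w<W. overlap a b c (Xs ! (w + u)) (Xs ! (w + v))) \<le> real (2 * LT_word (concat Xs))"
        unfolding of_nat_le_iff by auto
      with False show ?thesis by simp
    qed
  qed
  also have "\<dots> = 2 * real q * real q * ?T + 2 * real q * real l * real W"
    by (simp add: sum.distrib algebra_simps)
  finally show ?thesis .
qed

lemma sum_overlap_ge:
  assumes "distinct [a, b, c]"
    and "\<And>u. u \<in> U \<Longrightarrow> length (Y u) \<le> N"
    and "\<And>u v. D u v \<ge> \<bar>real (count_list (Y u) a) - real (count_list (Y v) a)\<bar>
                      + \<bar>real (count_list (Y u) c) - real (count_list (Y v) c)\<bar>"
  shows "(\<Sum>u\<in>U. \<Sum>v\<in>U. 17 / 18 * real (count_list (Y u) a) + real (count_list (Y u) c)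
      + real (gap_weight a b (Y u)) / 3 - 2 * D u v) \<le> (\<Sum>u\<in>U. \<Sum>v\<in>U. real (overlap a b c (Y u) (Y v)))"
proof -
  let ?g = "\<lambda>u. gaps a b (Y u)"
  have len: "length (?g u) \<le> N" if "u \<in> U" for u
    using assms(2)[OF that] count_le_length[of "Y u" a] by (simp add: length_gaps)
  have min: "real p - \<bar>real p - real p'\<bar> \<le> real (min p p')" for p p' :: nat
    by (auto simp: min_def)
  \<comment> \<open>The difference P is charged 17/18 + 2/3 < 2 and R is charged 1, so
    \<open>2 * d\<close> covers both.\<close>
  have combine: "17 / 18 * p + r + s - 2 * d \<le> (17 / 18 * p' + s - 2 / 3 * P) + r'"
    if "P + R \<le> d" "p - P \<le> p'" "r - R \<le> r'" "0 \<le> P" "0 \<le> R" for p p' P r r' R s d :: real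
    using that by (simp add: field_simps)
  have "(\<Sum>u\<in>U. \<Sum>v\<in>U. 17 / 18 * real (count_list (Y u) a) + real (count_list (Y u) c)
      + real (gap_weight a b (Y u)) / 3 - 2 * D u v)
    \<le> (\<Sum>u\<in>U. \<Sum>v\<in>U. (17 / 18 * min (length (?g u)) (length (?g v)) + real (sum_list (map (min 2) (?g u))) / 3
       - 2 / 3 * \<bar>real (length (?g u)) - real (length (?g v))\<bar>)
       + real (min (count_list (Y u) c) (count_list (Y v) c)))"
  proof (intro sum_mono)
    fix u v
    show "17 / 18 * real (count_list (Y u) a) + real (count_list (Y u) c)
      + real (gap_weight a b (Y u)) / 3 - 2 * D u v
      \<le> (17 / 18 * min (length (?g u)) (length (?g v)) + real (sum_list (map (min 2) (?g u))) / 3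
       - 2 / 3 * \<bar>real (length (?g u)) - real (length (?g v))\<bar>)
       + real (min (count_list (Y u) c) (count_list (Y v) c))"
      unfolding gap_weight_def length_gaps by (rule combine[OF assms(3) min min]) simp_all
  qed
  also have "\<dots> \<le> (\<Sum>u\<in>U. \<Sum>v\<in>U. real (length (common a b (?g u) (?g v))))
      + (\<Sum>u\<in>U. \<Sum>v\<in>U. real (min (count_list (Y u) c) (count_list (Y v) c)))"
    unfolding sum.distrib
    by (rule add_right_mono[OF sum_common_ge[OF len]])
  also have "\<dots> = (\<Sum>u\<in>U. \<Sum>v\<in>U. real (overlap a b c (Y u) (Y v)))"
    by (simp add: overlap_def sum.distrib)
  finally show ?thesis .
qed

lemma count_list_sum:
  assumes "finite A" "set w \<subseteq> A"
  shows "(\<Sum>a\<in>A. count_list w a) = length w"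
  using assms(2)
proof (induction w)
  case (Cons x w)
  have "(\<Sum>a\<in>A. count_list (x # w) a) = (\<Sum>a\<in>A. count_list w a + (if x = a then 1 else 0))"
    by (intro sum.cong) auto
  with Cons assms(1) show ?case by (simp add: sum.distrib)
qed simp

text \<open>
  All pairs \<open>u \<noteq> v\<close> in a window of \<open>q\<close> consecutive blocks are averaged; the pairs \<open>u = v\<close>, which
  Cauchy-Schwarz needs but which give no twins, account for the term \<open>9 l W / q\<close>.
\<close>

lemma twins_of_blocks:
  fixes x y z q l :: nat and \<mu> :: "nat \<Rightarrow> real" and W :: real
  assumes dist: "distinct [x, y, z]" and A: "A = {x, y, z}"
    and q: "0 < q" "q \<le> length Xs"
    and len: "\<And>X. X \<in> set Xs \<Longrightarrow> length X = l \<and> set X \<subseteq> A"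
  defines "W \<equiv> real (length Xs - q + 1)"
  shows "10 * real (LT_word (concat Xs)) \<ge> W * (41 / 12 * l - 2) - 9 * l * W / q
     - 18 * (\<Sum>i<length Xs. \<Sum>a\<in>A. \<bar>real (count_list (Xs ! i) a) - \<mu> a\<bar>)"
proof -
  define M where "M = length Xs - q + 1"
  define T where "T = real (LT_word (concat Xs))"
  define D where "D v w = (\<Sum>a\<in>A. \<bar>real (count_list v a) - real (count_list w a)\<bar>)" for v w
  define dev where "dev i = (\<Sum>a\<in>A. \<bar>real (count_list (Xs ! i) a) - \<mu> a\<bar>)" for i
  \<comment> \<open>Every estimate is summed over all windows and all pairs in a window, even where
    only one block matters, so that the estimates can be combined linearly.\<close>
  define SS :: "(nat \<Rightarrow> nat \<Rightarrow> real) \<Rightarrow> real"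
    where "SS f = (\<Sum>w<M. \<Sum>u<q. \<Sum>v<q. f (w + u) (w + v))" for f
  have W: "W = real M" by (simp add: W_def M_def)
  have SS_mono: "SS f \<le> SS g" if "\<And>i j. i < length Xs \<Longrightarrow> j < length Xs \<Longrightarrow> f i j \<le> g i j" for f g
    unfolding SS_def using q by (intro sum_mono that) (auto simp: M_def)
  have SS_add: "SS (\<lambda>i j. f i j + g i j) = SS f + SS g" for f g
    by (simp add: SS_def sum.distrib)
  have SS_mult: "SS (\<lambda>i j. c * f i j) = c * SS f" for c f
    by (simp add: SS_def sum_distrib_left)
  have SS_swap: "SS f = (\<Sum>u<q. \<Sum>v<q. \<Sum>w<M. f (w + u) (w + v))" for f
    unfolding SS_def by (rule trans[OF sum.swap sum.cong[OF refl sum.swap]])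
  have len_i: "length (Xs ! i) = l" "set (Xs ! i) \<subseteq> A" if "i < length Xs" for i
    using len[of "Xs ! i"] that by auto
  have in_range: "w + u < length Xs" if "w < M" "u < q" for w u
    using that q by (simp add: M_def)

  have dev: "SS (\<lambda>i j. D (Xs ! i) (Xs ! j)) \<le> 2 * real q * real q * (\<Sum>i<length Xs. dev i)"
  proof -
    have "SS (\<lambda>i j. D (Xs ! i) (Xs ! j)) \<le> SS (\<lambda>i j. dev i + dev j)"
    proof (intro SS_mono)
      fix i j
      show "D (Xs ! i) (Xs ! j) \<le> dev i + dev j"
        unfolding D_def dev_def sum.distrib[symmetric] by (intro sum_mono) linarith
    qed
    also have "\<dots> \<le> (\<Sum>u<q. \<Sum>v<q. 2 * (\<Sum>i<length Xs. dev i))"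
      unfolding SS_swap
    proof (intro sum_mono)
      fix u v assume "u \<in> {..<q}" "v \<in> {..<q}"
      then have "M + u \<le> length Xs" "M + v \<le> length Xs" using q by (auto simp: M_def)
      moreover have "0 \<le> dev i" for i by (simp add: dev_def sum_nonneg)
      ultimately have "(\<Sum>w<M. dev (w + u)) \<le> (\<Sum>i<length Xs. dev i)" "(\<Sum>w<M. dev (w + v)) \<le> (\<Sum>i<length Xs. dev i)"
        by (auto intro!: window_sum_le)
      then show "(\<Sum>w<M. dev (w + u) + dev (w + v)) \<le> 2 * (\<Sum>i<length Xs. dev i)"
        by (simp add: sum.distrib)
    qed
    finally show ?thesis by simp
  qed

  \<comment> \<open>Twins inside single blocks: \<open>LT_word_weight_ge\<close> divided by 4, then
    concatenated.\<close>
  have local: "SS (\<lambda>i j. l / 2 - weight A (Xs ! i) / 4 - 2) \<le> real q * real q * T"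
  proof -
    have "SS (\<lambda>i j. l / 2 - weight A (Xs ! i) / 4 - 2) \<le> SS (\<lambda>i j. LT_word (Xs ! i))"
    proof (intro SS_mono)
      fix i j assume "i < length Xs"
      then show "l / 2 - weight A (Xs ! i) / 4 - 2 \<le> LT_word (Xs ! i)"
        using LT_word_weight_ge[of A "Xs ! i"] len_i[of i] by (simp add: A)
    qed
    also have "\<dots> \<le> (\<Sum>u<q. \<Sum>v<q. T)"
      unfolding SS_swap
    proof (intro sum_mono)
      fix u assume "u \<in> {..<q}"
      then have "(\<Sum>w<M. LT_word (Xs ! (w + u))) \<le> (\<Sum>i<length Xs. LT_word (Xs ! i))"
        using q by (intro window_sum_le) (auto simp: M_def)
      also have "\<dots> \<le> LT_word (concat Xs)" by (rule LT_word_concat)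
      finally show "(\<Sum>w<M. real (LT_word (Xs ! (w + u)))) \<le> T"
        unfolding T_def of_nat_sum[symmetric] of_nat_le_iff .
    qed
    finally show ?thesis by simp
  qed

  define h where "h a b c i j = 17 / 18 * real (count_list (Xs ! i) a) + real (count_list (Xs ! i) c)
      + real (gap_weight a b (Xs ! i)) / 3 - 2 * D (Xs ! i) (Xs ! j)" for a b c i j
  have delayed: "SS (h a b c) \<le> 2 * real q * real q * T + 2 * real q * real l * real M"
    if "distinct [a, b, c]" "{a, b, c} = A" for a b c
  proof -
    have "SS (h a b c) \<le> SS (\<lambda>i j. real (overlap a b c (Xs ! i) (Xs ! j)))"
      unfolding SS_def h_def
    proof (rule sum_mono)
      fix w assume w: "w \<in> {..<M}"
      show "(\<Sum>u<q. \<Sum>v<q. 17 / 18 * real (count_list (Xs ! (w + u)) a) + real (count_list (Xs ! (w + u)) c)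
          + real (gap_weight a b (Xs ! (w + u))) / 3 - 2 * D (Xs ! (w + u)) (Xs ! (w + v)))
        \<le> (\<Sum>u<q. \<Sum>v<q. real (overlap a b c (Xs ! (w + u)) (Xs ! (w + v))))"
      proof (rule sum_overlap_ge[where Y = "\<lambda>u. Xs ! (w + u)" and N = l])
        show "length (Xs ! (w + u)) \<le> l" if "u \<in> {..<q}" for u
          using len_i[of "w + u"] in_range[of w u] that w by simp
        show "\<bar>real (count_list (Xs ! (w + u)) a) - real (count_list (Xs ! (w + v)) a)\<bar>
             + \<bar>real (count_list (Xs ! (w + u)) c) - real (count_list (Xs ! (w + v)) c)\<bar>
            \<le> D (Xs ! (w + u)) (Xs ! (w + v))" for u v
          using that(1) unfolding D_def that(2)[symmetric] by simp
      qed (rule that(1))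
    qed
    also have "\<dots> \<le> 2 * real q * real q * T + 2 * real q * real l * real M"
      unfolding SS_def T_def M_def using that(1) q len by (intro sum_window_overlap_le) auto
    finally show ?thesis .
  qed
  \<comment> \<open>Over the six assignments of roles each letter is \<open>a\<close> twice and
    \<open>c\<close> twice, which gives 2 (17/18 + 1) = 35/9 per position, and each ordered pair
    contributes its gap weight once.\<close>
  have "SS (\<lambda>i j. 35 / 9 * l + weight A (Xs ! i) / 3 - 12 * D (Xs ! i) (Xs ! j))
     \<le> SS (\<lambda>i j. h x y z i j + h x z y i j + h y x z i j + h y z x i j + h z x y i j + h z y x i j)"
  proof (intro SS_mono)
    fix i j assume "i < length Xs" "j < length Xs"
    then have "real l = count_list (Xs ! i) x + count_list (Xs ! i) y + count_list (Xs ! i) z"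
      using count_list_sum[of A "Xs ! i"] len_i[of i] dist A by auto
    moreover have "weight A (Xs ! i) = gap_weight x y (Xs ! i) + gap_weight x z (Xs ! i)
        + gap_weight y x (Xs ! i) + gap_weight y z (Xs ! i) + gap_weight z x (Xs ! i) + gap_weight z y (Xs ! i)"
      using dist by (simp add: weight_def A insert_Diff_if)
    ultimately show "35 / 9 * l + weight A (Xs ! i) / 3 - 12 * D (Xs ! i) (Xs ! j)
      \<le> h x y z i j + h x z y i j + h y x z i j + h y z x i j + h z x y i j + h z y x i j"
      by (simp add: h_def field_simps)
  qed
  also have "\<dots> \<le> 12 * real q * real q * T + 12 * real q * real l * real M"
    unfolding SS_add
    using delayed[of x y z] delayed[of x z y] delayed[of y x z] delayed[of y z x] delayed[of z x y] delayed[of z y x]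
      dist A by (auto simp: insert_commute)
  finally have delayed_all: "SS (\<lambda>i j. 35 / 9 * l + weight A (Xs ! i) / 3 - 12 * D (Xs ! i) (Xs ! j))
     \<le> 12 * real q * real q * T + 12 * real q * real l * real M" .

  \<comment> \<open>The factor 3/4 makes the weight cancel: 3/4 * 1/3 = 1/4. What remains is 3/4 *
    35/9 + 1/2 = 41/12 against (3/4 * 12 + 1) T = 10 T.\<close>
  have "SS (\<lambda>i j. 41 / 12 * l - 2)
     = 3 / 4 * SS (\<lambda>i j. 35 / 9 * l + weight A (Xs ! i) / 3 - 12 * D (Xs ! i) (Xs ! j))
       + SS (\<lambda>i j. l / 2 - weight A (Xs ! i) / 4 - 2) + 9 * SS (\<lambda>i j. D (Xs ! i) (Xs ! j))"
    unfolding SS_mult[symmetric] SS_add[symmetric] by (simp add: algebra_simps)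
  also have "\<dots> \<le> 3 / 4 * (12 * real q * real q * T + 12 * real q * real l * real M)
      + real q * real q * T + 9 * (2 * real q * real q * (\<Sum>i<length Xs. dev i))"
    by (intro add_mono mult_left_mono delayed_all local dev) auto
  finally have "real q * real q * (real M * (41 / 12 * l - 2))
      \<le> real q * real q * (10 * T + 18 * (\<Sum>i<length Xs. dev i) + 9 * l * real M / q)"
    using q(1) by (simp add: SS_def algebra_simps)
  then have "real M * (41 / 12 * l - 2) \<le> 10 * T + 18 * (\<Sum>i<length Xs. dev i) + 9 * l * real M / q"
    using q(1) by (simp add: mult_le_cancel_left)
  then show ?thesis by (simp add: T_def W dev_def)
qed

section \<open>Energy increment\<close>

text \<open>The sum of squared letter frequencies multiplied by the length. With this scaling the
  energies of blocks can be added and compared with that of their concatenation.\<close>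

definition energy :: "'a set \<Rightarrow> 'a list \<Rightarrow> real" where
  "energy A w = (\<Sum>a\<in>A. (real (count_list w a))\<^sup>2 / length w)"

lemma energy_le:
  assumes "finite A" "set w \<subseteq> A"
  shows "energy A w \<le> length w"
proof (cases "w = []")
  case False
  have "energy A w \<le> (\<Sum>a\<in>A. real (count_list w a))"
    unfolding energy_def
  proof (intro sum_mono)
    fix a
    have "(real (count_list w a))\<^sup>2 \<le> real (count_list w a) * length w"
      unfolding power2_eq_square by (intro mult_left_mono) (auto simp: count_le_length)
    with False show "(real (count_list w a))\<^sup>2 / length w \<le> real (count_list w a)"
      by (simp add: divide_simps)
  qed
  also have "\<dots> = length w"
    using count_list_sum[OF assms] by (simp flip: of_nat_sum)
  finally show ?thesis .
qed (simp add: energy_def)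

lemma sum_squared_deviation:
  fixes f :: "nat \<Rightarrow> real"
  assumes "m > 0"
  shows "(\<Sum>i<m. (f i - (\<Sum>i<m. f i) / m)\<^sup>2) = (\<Sum>i<m. (f i)\<^sup>2) - (\<Sum>i<m. f i)\<^sup>2 / m"
proof -
  define \<mu> where "\<mu> = (\<Sum>i<m. f i) / m"
  have "(\<Sum>i<m. (f i - \<mu>)\<^sup>2) = (\<Sum>i<m. (f i)\<^sup>2 - 2 * \<mu> * f i + \<mu>\<^sup>2)"
    by (simp add: power2_diff algebra_simps)
  also have "\<dots> = (\<Sum>i<m. (f i)\<^sup>2) - 2 * \<mu> * (\<Sum>i<m. f i) + m * \<mu>\<^sup>2"
    by (simp add: sum.distrib sum_subtractf sum_distrib_left)
  also have "\<dots> = (\<Sum>i<m. (f i)\<^sup>2) - (\<Sum>i<m. f i)\<^sup>2 / m"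
    using assms by (simp add: \<mu>_def power2_eq_square field_simps)
  finally show ?thesis by (simp add: \<mu>_def)
qed

lemma count_list_concat: "count_list (concat Xs) a = (\<Sum>i<length Xs. count_list (Xs ! i) a)"
proof (induction Xs)
  case (Cons X Xs)
  then show ?case by (simp add: sum.lessThan_Suc_shift del: sum.lessThan_Suc)
qed simp

lemma length_concat_uniform:
  "(\<And>X. X \<in> set Xs \<Longrightarrow> length X = l) \<Longrightarrow> length (concat Xs) = length Xs * l"
  by (induction Xs) auto

text \<open>By AM-GM, \<open>|t| \<le> \<eta> l + t\<^sup>2 / (4 \<eta> l)\<close>. The squared
  deviations from the mean, divided by l, add up exactly to the energy gained by splitting.\<close>

lemma sum_deviation_le_energy:
  fixes l :: nat and \<eta> :: real
  assumes "finite A" "Xs \<noteq> []" "l > 0" "\<And>X. X \<in> set Xs \<Longrightarrow> length X = l" "\<eta> > 0"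
  shows "(\<Sum>i<length Xs. \<Sum>a\<in>A. \<bar>real (count_list (Xs ! i) a) - count_list (concat Xs) a / length Xs\<bar>)
    \<le> card A * length Xs * \<eta> * l + ((\<Sum>i<length Xs. energy A (Xs ! i)) - energy A (concat Xs)) / (4 * \<eta>)"
proof -
  let ?m = "length Xs"
  let ?d = "\<lambda>i a. real (count_list (Xs ! i) a) - count_list (concat Xs) a / ?m"
  have m: "?m > 0" using assms(2) by simp
  have am_gm: "\<bar>t\<bar> \<le> \<eta> * l + t\<^sup>2 / l / (4 * \<eta>)" for t :: real
  proof -
    have "0 \<le> (\<bar>t\<bar> - 2 * \<eta> * l)\<^sup>2" by simp
    then have "4 * \<eta> * l * \<bar>t\<bar> \<le> 4 * \<eta> * l * (\<eta> * l) + t\<^sup>2"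
      by (simp add: power2_eq_square algebra_simps)
    then show ?thesis using assms(3,5) by (simp add: field_simps)
  qed
  have "(\<Sum>i<?m. \<Sum>a\<in>A. \<bar>?d i a\<bar>) \<le> (\<Sum>i<?m. \<Sum>a\<in>A. \<eta> * l + (?d i a)\<^sup>2 / l / (4 * \<eta>))"
    by (intro sum_mono am_gm)
  also have "\<dots> = card A * ?m * \<eta> * l + (\<Sum>a\<in>A. (\<Sum>i<?m. (?d i a)\<^sup>2) / l) / (4 * \<eta>)"
    by (simp add: sum.distrib sum_divide_distrib sum.swap[of _ A])
  also have "(\<Sum>a\<in>A. (\<Sum>i<?m. (?d i a)\<^sup>2) / l)
     = (\<Sum>a\<in>A. (\<Sum>i<?m. (real (count_list (Xs ! i) a))\<^sup>2 / l) - (real (count_list (concat Xs) a))\<^sup>2 / (?m * l))"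
  proof (intro sum.cong refl)
    fix a
    show "(\<Sum>i<?m. (?d i a)\<^sup>2) / l
      = (\<Sum>i<?m. (real (count_list (Xs ! i) a))\<^sup>2 / l) - (real (count_list (concat Xs) a))\<^sup>2 / (?m * l)"
      using sum_squared_deviation[OF m, of "\<lambda>i. real (count_list (Xs ! i) a)"]
      by (simp add: count_list_concat diff_divide_distrib sum_divide_distrib)
  qed
  also have "\<dots> = (\<Sum>i<?m. energy A (Xs ! i)) - energy A (concat Xs)"
    using assms(4) length_concat_uniform[of Xs l]
    by (simp add: energy_def sum_subtractf sum.swap[of _ A])
  finally show ?thesis .
qed

text \<open>Uses \<open>twins_of_blocks\<close> with q = 3600 and \<eta> = 1/20000. Per letter,
  41/12 loses 0.0025 for pairs u = v, 0.002 for the additive constant as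
  \<open>l \<ge> 1000\<close>, less than 0.001 because there are q - 1 fewer windows than blocks,
  and 18 * 3/20000 = 0.0027 for deviations; more than 3.405 is left. The energy factor is 18 * 5000
  / 10.\<close>

lemma twins_energy_step:
  fixes x y z l :: nat
  assumes "distinct [x, y, z]" "A = {x, y, z}" "length Xs = 3600 * 3600" "l \<ge> 1000"
    and len: "\<And>X. X \<in> set Xs \<Longrightarrow> length X = l \<and> set X \<subseteq> A"
  shows "LT_word (concat Xs) \<ge> 0.3405 * length (concat Xs)
     - 9000 * ((\<Sum>i<length Xs. energy A (Xs ! i)) - energy A (concat Xs))"
proof -
  let ?\<Delta> = "(\<Sum>i<length Xs. energy A (Xs ! i)) - energy A (concat Xs)"
  let ?dev = "(\<Sum>i<length Xs. \<Sum>a\<in>A. \<bar>real (count_list (Xs ! i) a) - count_list (concat Xs) a / length Xs\<bar>)"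
  have "card A = 3" "finite A" "Xs \<noteq> []" "l > 0" using assms(1-4) by auto
  then have dev: "?dev \<le> 3 * real (length Xs) * l / 20000 + 5000 * ?\<Delta>"
    using sum_deviation_le_energy[where A = A and Xs = Xs and l = l and \<eta> = "1 / 20000"] len by simp
  have "10 * real (LT_word (concat Xs)) \<ge> real (length Xs - 3600 + 1) * (41 / 12 * l - 2)
      - 9 * l * real (length Xs - 3600 + 1) / 3600 - 18 * ?dev"
    using twins_of_blocks[of x y z A 3600 Xs l "\<lambda>a. count_list (concat Xs) a / length Xs"] assms by simp
  with dev show ?thesis
    using assms(3,4) length_concat_uniform[of Xs l] len by simp
qed

lemma blocks_exist:
  "length w = m * l \<Longrightarrow> \<exists>Xs. length Xs = m \<and> concat Xs = w \<and> (\<forall>X\<in>set Xs. length X = l)"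
proof (induction m arbitrary: w)
  case (Suc m)
  then have "length (drop l w) = m * l" by simp
  then obtain Xs where "length Xs = m" "concat Xs = drop l w" "\<forall>X\<in>set Xs. length X = l"
    using Suc.IH by blast
  with Suc.prems show ?case by (intro exI[of _ "take l w # Xs"]) auto
qed simp

text \<open>Adding the step for w to the induction hypothesis for its m blocks makes the energies
  telescope over the n scales. As the energy never exceeds the length, the total error stays at 9000
  per letter however large n is.\<close>

lemma twins_energy_iterate:
  fixes x y z :: nat
  assumes "distinct [x, y, z]" "A = {x, y, z}" "m = 3600 * 3600" "length w = 1000 * m ^ n" "set w \<subseteq> A"
  shows "n * LT_word w \<ge> 0.3405 * n * length w - 9000 * (length w - energy A w)"
  using assms(4,5)
proof (induction n arbitrary: w)
  case 0
  then show ?case using energy_le[of A w] assms(2) by simp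
next
  case (Suc n)
  define l where "l = 1000 * m ^ n"
  obtain Xs where Xs: "length Xs = m" "concat Xs = w" "\<forall>X\<in>set Xs. length X = l"
    using Suc.prems(1) blocks_exist[of w m l] by (auto simp: l_def)
  have sub: "set X \<subseteq> A" if "X \<in> set Xs" for X
    using that Suc.prems(2) unfolding Xs(2)[symmetric] set_concat by blast
  have "l \<ge> 1000" using assms(3) by (simp add: l_def)
  then have step: "LT_word w \<ge> 0.3405 * length w - 9000 * ((\<Sum>i<m. energy A (Xs ! i)) - energy A w)"
    using twins_energy_step[of x y z A Xs l] assms(1-3) Xs sub by auto
  have "(\<Sum>i<m. 0.3405 * n * l - 9000 * (l - energy A (Xs ! i))) \<le> (\<Sum>i<m. real n * LT_word (Xs ! i))"
  proof (intro sum_mono)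
    fix i assume "i \<in> {..<m}"
    then have "Xs ! i \<in> set Xs" using Xs(1) by auto
    then show "0.3405 * n * l - 9000 * (l - energy A (Xs ! i)) \<le> real n * LT_word (Xs ! i)"
      using Suc.IH[of "Xs ! i"] Xs(3) sub[of "Xs ! i"] by (auto simp: l_def)
  qed
  also have "\<dots> = n * real (\<Sum>i<length Xs. LT_word (Xs ! i))"
    by (simp add: sum_distrib_left Xs(1))
  also have "\<dots> \<le> n * real (LT_word w)"
    using LT_word_concat[of Xs] Xs(2) by (intro mult_left_mono of_nat_mono) auto
  also have "(\<Sum>i<m. 0.3405 * n * l - 9000 * (l - energy A (Xs ! i)))
      = 0.3405 * n * (real m * l) - 9000 * (real m * l - (\<Sum>i<m. energy A (Xs ! i)))"
    by (simp add: sum_subtractf flip: sum_distrib_left)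
  also have "real m * l = length w"
    using length_concat_uniform[of Xs l] Xs by simp
  finally have "0.3405 * n * real (length w) - 9000 * (length w - (\<Sum>i<m. energy A (Xs ! i))) \<le> n * LT_word w" by simp
  with step show ?case by (simp add: field_simps)
qed

section \<open>All words over three letters\<close>

lemma twins_three_letters:
  obtains N :: nat where "\<And>x y z w. distinct [x, y, z] \<Longrightarrow> set w \<subseteq> {x, y, z} \<Longrightarrow>
    LT_word w \<ge> 0.34 * (real (length w) - N)"
proof -
  define m :: nat where "m = 3600 * 3600"
  \<comment> \<open>Then 9000 / n is below 0.0005 = 0.3405 - 0.34.\<close>
  obtain n :: nat where n: "18000000 < real n" using reals_Archimedean2 by blast
  define N where "N = 1000 * m ^ n"
  have N: "N > 0" by (simp add: N_def m_def)
  have block: "LT_word w \<ge> 0.34 * real N"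
    if "distinct [x, y, z]" "set w \<subseteq> {x, y, z}" "length w = N" for x y z w
  proof -
    have "0 \<le> energy {x, y, z} w" by (simp add: energy_def sum_nonneg)
    then have "n * LT_word w \<ge> 0.3405 * n * real N - 9000 * N"
      using twins_energy_iterate[OF that(1) refl m_def _ that(2), of n] that(3) by (simp add: N_def)
    moreover have "9000 * real N \<le> 0.0005 * n * real N"
      using n by (intro mult_right_mono) auto
    ultimately have "n * (0.34 * real N) \<le> n * real (LT_word w)" by (simp add: algebra_simps)
    then show ?thesis using n by (simp add: mult_le_cancel_left)
  qed
  show thesis
  proof (rule that[of N])
    fix x y z :: nat and w
    assume xyz: "distinct [x, y, z]" "set w \<subseteq> {x, y, z}"
    \<comment> \<open>Long words are cut into p blocks of the fixed length N; the rest is shorter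
      than N and is dropped.\<close>
    define p where "p = length w div N"
    have "p * N \<le> length w" by (simp add: p_def)
    then obtain Xs where Xs: "length Xs = p" "concat Xs = take (p * N) w" "\<forall>X\<in>set Xs. length X = N"
      using blocks_exist[of "take (p * N) w" p N] by auto
    have "0.34 * (real (length w) - N) \<le> (\<Sum>i<p. 0.34 * real N)"
    proof -
      have "length w < p * N + N" using N div_mult_mod_eq[of "length w" N] mod_less_divisor[of N "length w"]
        unfolding p_def by linarith
      then have "real (length w) < real (p * N + N)" by (simp only: of_nat_less_iff)
      then show ?thesis by simp
    qed
    also have "\<dots> \<le> (\<Sum>i<p. real (LT_word (Xs ! i)))"
    proof (intro sum_mono)
      fix i assume "i \<in> {..<p}"
      then have "Xs ! i \<in> set Xs" using Xs(1) by auto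
      moreover from this have "set (Xs ! i) \<subseteq> {x, y, z}"
        using xyz(2) Xs(2) set_take_subset[of "p * N" w] by (metis UN_upper set_concat subset_trans)
      ultimately show "0.34 * real N \<le> real (LT_word (Xs ! i))"
        using block[OF xyz(1)] Xs(3) by blast
    qed
    also have "\<dots> \<le> LT_word (concat Xs)"
      using LT_word_concat[of Xs] Xs(1) by (simp flip: of_nat_sum)
    also have "LT_word (concat Xs) \<le> LT_word w"
      unfolding Xs(2) by (rule LT_word_mono) (metis append_take_drop_id subseq_order.order_refl list_emb_append2 list_emb_prefix)
    finally show "0.34 * (real (length w) - N) \<le> LT_word w" by simp
  qed
qed

section \<open>Reduction to three letters\<close>

text \<open>The values at x, y, z are successive maxima, so each of the other
  \<open>card A - 3\<close> values is at most \<open>f z\<close> and hence at most the mean of the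
  three.\<close>

lemma three_largest_sum_ge:
  fixes f :: "'b \<Rightarrow> nat"
  assumes "finite A" "card A \<ge> 3"
  obtains x y z where "distinct [x, y, z]" "{x, y, z} \<subseteq> A" "3 * sum f A \<le> card A * (f x + f y + f z)"
proof -
  have max: "\<exists>x\<in>B. \<forall>b\<in>B. f b \<le> f x" if "finite B" "B \<noteq> {}" for B :: "'b set"
  proof -
    have "Max (f ` B) \<in> f ` B" using that by (intro Max_in) auto
    then obtain x where "x \<in> B" "f x = Max (f ` B)" by auto
    then show ?thesis using that by (intro bexI[of _ x]) auto
  qed
  have "A \<noteq> {}" using assms by auto
  then obtain x where x: "x \<in> A" "\<forall>b\<in>A. f b \<le> f x" using max[of A] assms by auto
  have "card (A - {x}) \<ge> 2" using assms x by simp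
  then have "A - {x} \<noteq> {}" by fastforce
  then obtain y where y: "y \<in> A - {x}" "\<forall>b\<in>A - {x}. f b \<le> f y" using max[of "A - {x}"] assms by auto
  have card2: "card (A - {x} - {y}) = card A - 2" using assms x y by simp
  then have "A - {x} - {y} \<noteq> {}" using assms(2) by fastforce
  then obtain z where z: "z \<in> A - {x} - {y}" "\<forall>b\<in>A - {x} - {y}. f b \<le> f z"
    using max[of "A - {x} - {y}"] assms by auto
  have "sum f A = f x + (f y + sum f (A - {x} - {y}))"
    using assms x y by (simp add: sum.remove[of A x] sum.remove[of "A - {x}" y])
  also have "sum f (A - {x} - {y}) \<le> (card A - 2) * f z"
    using z(2) sum_bounded_above[of "A - {x} - {y}" f "f z"] card2 by auto
  finally have le: "sum f A \<le> f x + f y + (card A - 2) * f z" by simp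
  obtain r where r: "card A = 3 + r" using assms(2) le_Suc_ex by blast
  have "f z \<le> f y" "f y \<le> f x" using x y z by auto
  then have "r * f z \<le> r * f y" "r * f z \<le> r * f x"
    by (auto intro: mult_le_mono2)
  moreover have "sum f A \<le> f x + f y + f z + r * f z"
    using le by (simp add: r algebra_simps)
  ultimately have "3 * sum f A \<le> card A * (f x + f y + f z)"
    unfolding r distrib_left distrib_right by linarith
  with x y z show thesis by (intro that[of x y z]) auto
qed

theorem theorem2:
  fixes k :: nat
  assumes "k \<ge> 3"
  shows "\<exists>f :: nat \<Rightarrow> real. f \<in> o(\<lambda>n. real n) \<and>
           (\<forall>n. real (LT k n) \<ge> 1.02 / real k * real n - f n)"
proof -
  obtain N :: nat where N: "\<And>x y z w. distinct [x, y, z] \<Longrightarrow> set w \<subseteq> {x, y, z} \<Longrightarrow>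
    LT_word w \<ge> 0.34 * (real (length w) - N)" using twins_three_letters by blast
  have "LT k n \<ge> 1.02 / real k * real n - 0.34 * real N" for n
  proof -
    have "finite {w. set w \<subseteq> {1..k} \<and> length w = n}" by (rule finite_lists_length_eq) simp
    then have "finite {LT_word w | w. length w = n \<and> set w \<subseteq> {1..k}}"
      by (simp add: conj_commute)
    \<comment> \<open>A witness that the minimum is taken over a nonempty set, so that some word
      attains it.\<close>
    moreover have "length (replicate n 1) = n \<and> set (replicate n 1) \<subseteq> {1..k}"
      using assms by auto
    then have "{LT_word w | w. length w = n \<and> set w \<subseteq> {1..k}} \<noteq> {}" by blast
    ultimately have "LT k n \<in> {LT_word w | w. length w = n \<and> set w \<subseteq> {1..k}}"
      unfolding LT_def by (rule Min_in)
    then obtain w where w: "LT k n = LT_word w" "length w = n" "set w \<subseteq> {1..k}" by blast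
    obtain x y z where xyz: "distinct [x, y, z]" "{x, y, z} \<subseteq> {1..k}"
      "3 * (\<Sum>a\<in>{1..k}. count_list w a) \<le> card {1..k} * (count_list w x + count_list w y + count_list w z)"
      using three_largest_sum_ge[of "{1..k}" "count_list w"] assms by auto
    define v where "v = filter (\<lambda>a. a \<in> {x, y, z}) w"
    have "length v = (\<Sum>a\<in>{x, y, z}. count_list v a)"
      by (intro count_list_sum[symmetric]) (auto simp: v_def)
    also have "\<dots> = (\<Sum>a\<in>{x, y, z}. count_list w a)"
    proof (rule sum.cong[OF refl])
      fix a assume "a \<in> {x, y, z}"
      then show "count_list v a = count_list w a"
        unfolding v_def by (induction w) auto
    qed
    also have "\<dots> = count_list w x + count_list w y + count_list w z"
      using xyz(1) by simp
    finally have "3 * n \<le> k * length v"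
      using xyz(3) count_list_sum[of "{1..k}" w] w by simp
    then have "3 * real n \<le> real k * real (length v)"
      by (metis of_nat_le_iff of_nat_mult of_nat_numeral)
    \<comment> \<open>The constant is 1.02 = 3 * 0.34.\<close>
    then have "1.02 / real k * real n \<le> 0.34 * length v"
      using assms by (simp add: field_simps)
    moreover have "0.34 * (real (length v) - N) \<le> LT_word v"
      by (rule N[OF xyz(1)]) (auto simp: v_def)
    moreover have "LT_word v \<le> LT_word w"
      unfolding v_def by (rule LT_word_mono) (rule subseq_filter_left)
    then have "real (LT_word v) \<le> LT k n" using w(1) by simp
    ultimately show ?thesis unfolding right_diff_distrib by linarith
  qed
  moreover have "(\<lambda>n. 0.34 * real N) \<in> o(\<lambda>n. real n)"
    by (intro smalloI_tendsto lim_const_over_n eventually_mono[OF eventually_gt_at_top[of 0]]) simp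
  ultimately show ?thesis by (intro exI[of _ "\<lambda>n. 0.34 * real N"]) auto
qed

end
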